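(* Let $T\in\mathcal{A}_n[\mathbb{C}]$ with symbol $F_T(z,w)$. If $F_T(z_1,\ldots,z_n,-w_1,\ldots,-w_n)\in\mathcal{H}_{2n}^s(\mathbb{C})$, then $T\in\mathcal{A}_n^s(\mathbb{C})$.
   Context: $\mathcal{A}_n[\mathbb{C}]$ is the Weyl algebra of operators $T=\sum_{\alpha,\beta\in\mathbb{N}^n}a_{\alpha\beta}z^\alpha\partial^\beta$ (finite sum, $\partial_i=\partial/\partial z_i$, multi-index notation, $a_{\alpha\beta}\in\mathbb{C}$) on $\mathbb{C}[z_1,\ldots,z_n]$; the symbol of $T$ is $F_T(z,w)=\sum_{\alpha,\beta}a_{\alpha\beta}z^\alpha w^\beta$. A polynomial $g\in\mathbb{C}[z_1,\ldots,z_m]$ is strictly stable if $g(z_1,\ldots,z_m)\neq 0$ for all $(z_1,\ldots,z_m)\in\mathbb{C}^m$ with $\operatorname{Im}(z_j)\ge 0$, $1\le j\le m$; $\mathcal{H}_m^s(\mathbb{C})$ denotes the set of strictly stable polynomials in $m$ variables. $\mathcal{A}_n^s(\mathbb{C})=\{T\in\mathcal{A}_n[\mathbb{C}]: T(\mathcal{H}_n^s(\mathbb{C}))\subseteq\mathcal{H}_n^s(\mathbb{C})\cup\{0\}\}$. *)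

theory Defs
  imports Complex_Main "HOL-Library.Poly_Mapping"
begin

text \<open>
  A finite type \<open>'v\<close> indexes the variables, so \<open>'v mpoly\<close> is the polynomial ring
  \<open>\<complex>[z\<^sub>1, \<dots>, z\<^sub>m]\<close> with \<open>m = CARD('v)\<close>, as formal polynomials; its ring structure is the
  convolution product of \<^theory>\<open>HOL-Library.Poly_Mapping\<close>.
  Polynomials in the \<open>2n\<close> variables \<open>(z, w)\<close> have variables indexed by \<open>'n + 'n\<close>, where \<open>Inl i\<close>
  stands for \<open>z\<^sub>i\<close> and \<open>Inr i\<close> for \<open>w\<^sub>i\<close>.
\<close>

type_synonym 'v mpoly = "('v \<Rightarrow>\<^sub>0 nat) \<Rightarrow>\<^sub>0 complex"

definition mconst :: "complex \<Rightarrow> 'v mpoly" where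
  "mconst c = Poly_Mapping.single 0 c"

definition mvar :: "'v \<Rightarrow> 'v mpoly" where
  "mvar i = Poly_Mapping.single (Poly_Mapping.single i 1) 1"

text \<open>Multi-index power \<open>x\<^sup>\<alpha>\<close>, of a tuple of scalars or of polynomials.\<close>

definition mpow :: "('v::finite \<Rightarrow> 'a::comm_monoid_mult) \<Rightarrow> ('v \<Rightarrow>\<^sub>0 nat) \<Rightarrow> 'a" where
  "mpow x \<alpha> = (\<Prod>i\<in>UNIV. x i ^ Poly_Mapping.lookup \<alpha> i)"

definition mpoly_eval :: "'v::finite mpoly \<Rightarrow> ('v \<Rightarrow> complex) \<Rightarrow> complex" where
  "mpoly_eval p z = (\<Sum>\<alpha>\<in>Poly_Mapping.keys p. Poly_Mapping.lookup p \<alpha> * mpow z \<alpha>)"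

definition mpoly_subst :: "'v::finite mpoly \<Rightarrow> ('v \<Rightarrow> 'u mpoly) \<Rightarrow> 'u mpoly" where
  "mpoly_subst p s =
     (\<Sum>\<alpha>\<in>Poly_Mapping.keys p. mconst (Poly_Mapping.lookup p \<alpha>) * mpow s \<alpha>)"

definition strictly_stable_polys :: "'v::finite mpoly set" where
  "strictly_stable_polys =
     {g. \<forall>z. (\<forall>j. Im (z j) \<ge> 0) \<longrightarrow> mpoly_eval g z \<noteq> 0}"

text \<open>If \<open>\<alpha> i = 0\<close>, the exponent difference below is truncated, but the coefficient is \<open>0\<close>.\<close>

definition pderiv_var :: "'v \<Rightarrow> 'v mpoly \<Rightarrow> 'v mpoly" where
  "pderiv_var i p =
     (\<Sum>\<alpha>\<in>Poly_Mapping.keys p.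
        Poly_Mapping.single (\<alpha> - Poly_Mapping.single i 1)
          (of_nat (Poly_Mapping.lookup \<alpha> i) * Poly_Mapping.lookup p \<alpha>))"

text \<open>
  \<open>\<partial>\<^sup>\<beta>\<close>, the composition of the \<open>\<partial>\<^sub>i\<^bsup>\<beta> i\<^esup>\<close>. The fold does not depend on the order
  because the \<open>\<partial>\<^sub>i\<close> commute (\<open>pderiv_var_commute\<close>).
\<close>

definition mderiv :: "('v::finite \<Rightarrow>\<^sub>0 nat) \<Rightarrow> 'v mpoly \<Rightarrow> 'v mpoly" where
  "mderiv \<beta> p = Finite_Set.fold (\<lambda>i. pderiv_var i ^^ Poly_Mapping.lookup \<beta> i) p UNIV"

text \<open>
  The operator \<open>\<Sum> a\<^sub>\<alpha>\<^sub>\<beta> z\<^sup>\<alpha> \<partial>\<^sup>\<beta>\<close> of a finitely supported family \<open>a\<close>. The family is determined by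
  the operator (\<open>inj_weyl_op\<close>), so that the symbol of an operator is well defined.
\<close>

definition weyl_op ::
  "(('n::finite \<Rightarrow>\<^sub>0 nat) \<times> ('n \<Rightarrow>\<^sub>0 nat) \<Rightarrow>\<^sub>0 complex) \<Rightarrow> 'n mpoly \<Rightarrow> 'n mpoly" where
  "weyl_op a p =
     (\<Sum>(\<alpha>, \<beta>)\<in>Poly_Mapping.keys a.
        mconst (Poly_Mapping.lookup a (\<alpha>, \<beta>)) * mpow mvar \<alpha> * mderiv \<beta> p)"

definition weyl_algebra :: "('n::finite mpoly \<Rightarrow> 'n mpoly) set" where
  "weyl_algebra = range weyl_op"

definition weyl_coeffs ::
  "('n::finite mpoly \<Rightarrow> 'n mpoly) \<Rightarrow> (('n \<Rightarrow>\<^sub>0 nat) \<times> ('n \<Rightarrow>\<^sub>0 nat) \<Rightarrow>\<^sub>0 complex)" where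
  "weyl_coeffs T = (THE a. T = weyl_op a)"

definition weyl_symbol :: "('n::finite mpoly \<Rightarrow> 'n mpoly) \<Rightarrow> ('n + 'n) mpoly" where
  "weyl_symbol T =
     (\<Sum>(\<alpha>, \<beta>)\<in>Poly_Mapping.keys (weyl_coeffs T).
        mconst (Poly_Mapping.lookup (weyl_coeffs T) (\<alpha>, \<beta>)) *
        mpow (\<lambda>i. mvar (Inl i)) \<alpha> * mpow (\<lambda>i. mvar (Inr i)) \<beta>)"

definition stable_weyl_algebra :: "('n::finite mpoly \<Rightarrow> 'n mpoly) set" where
  "stable_weyl_algebra =
     {T \<in> weyl_algebra. T ` strictly_stable_polys \<subseteq> strictly_stable_polys \<union> {0}}"


lemma lookup_pderiv_var:
  "Poly_Mapping.lookup (pderiv_var i p) \<gamma> =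
     of_nat (Poly_Mapping.lookup \<gamma> i + 1) * Poly_Mapping.lookup p (\<gamma> + Poly_Mapping.single i 1)"
proof -
  let ?e = "Poly_Mapping.single i (1::nat)"
  have eq: "(of_nat (Poly_Mapping.lookup \<alpha> i) * Poly_Mapping.lookup p \<alpha> when \<alpha> - ?e = \<gamma>) =
        (if \<alpha> = \<gamma> + ?e then of_nat (Poly_Mapping.lookup \<gamma> i + 1) * Poly_Mapping.lookup p \<alpha> else 0)"
    for \<alpha>
  proof (cases "Poly_Mapping.lookup \<alpha> i = 0")
    case True
    then have "\<alpha> \<noteq> \<gamma> + ?e" by (auto simp: lookup_add)
    with True show ?thesis by simp
  next
    case False
    have "\<alpha> - ?e = \<gamma> \<longleftrightarrow> \<alpha> = \<gamma> + ?e"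
    proof
      assume "\<alpha> - ?e = \<gamma>"
      then have "\<gamma> + ?e = \<alpha> - ?e + ?e" by simp
      also have "\<dots> = \<alpha>"
        using False
        by (intro poly_mapping_eqI) (auto simp: lookup_add lookup_minus lookup_single when_def)
      finally show "\<alpha> = \<gamma> + ?e" by simp
    qed simp
    then show ?thesis by (auto simp: lookup_add when_def)
  qed
  have "Poly_Mapping.lookup (pderiv_var i p) \<gamma> =
      (\<Sum>\<alpha>\<in>Poly_Mapping.keys p.
        if \<alpha> = \<gamma> + ?e then of_nat (Poly_Mapping.lookup \<gamma> i + 1) * Poly_Mapping.lookup p \<alpha> else 0)"
    unfolding pderiv_var_def lookup_sum lookup_single eq ..
  also have "\<dots> = of_nat (Poly_Mapping.lookup \<gamma> i + 1) * Poly_Mapping.lookup p (\<gamma> + ?e)"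
    by (simp add: sum.delta' sum.delta in_keys_iff)
  finally show ?thesis .
qed

lemma pderiv_var_commute: "pderiv_var i (pderiv_var j p) = pderiv_var j (pderiv_var i p)"
  by (intro poly_mapping_eqI)
    (auto simp: lookup_pderiv_var lookup_add lookup_single when_def add_ac mult_ac)

lemma lookup_pderiv_var_funpow:
  "Poly_Mapping.lookup ((pderiv_var i ^^ k) p) \<gamma> =
     pochhammer (of_nat (Poly_Mapping.lookup \<gamma> i + 1)) k *
     Poly_Mapping.lookup p (\<gamma> + Poly_Mapping.single i k)"
proof (induction k arbitrary: \<gamma>)
  case (Suc k)
  have "\<gamma> + Poly_Mapping.single i 1 + Poly_Mapping.single i k = \<gamma> + Poly_Mapping.single i (Suc k)"
    by (simp add: add.assoc flip: single_add)
  then show ?case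
    by (simp add: lookup_pderiv_var Suc lookup_add pochhammer_rec add_ac mult_ac)
qed simp

lemma comp_fun_commute_pderiv:
  fixes k :: "'v \<Rightarrow> nat"
  shows "comp_fun_commute (\<lambda>i. pderiv_var i ^^ k i)"
proof
  fix i j :: 'v
  have 1: "pderiv_var i ((pderiv_var j ^^ n) p) = (pderiv_var j ^^ n) (pderiv_var i p)" for i j :: 'v and n p
    by (induction n) (simp_all add: pderiv_var_commute[of i j])
  have "(pderiv_var j ^^ m) ((pderiv_var i ^^ n) p) = (pderiv_var i ^^ n) ((pderiv_var j ^^ m) p)"
    for m n p
    by (induction n) (simp_all flip: 1)
  then show "(pderiv_var j ^^ k j) \<circ> (pderiv_var i ^^ k i) =
      (pderiv_var i ^^ k i) \<circ> (pderiv_var j ^^ k j)"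
    by (simp add: fun_eq_iff)
qed

lemma lookup_mderiv:
  "Poly_Mapping.lookup (mderiv \<beta> p) \<gamma> =
     (\<Prod>i\<in>UNIV. pochhammer (of_nat (Poly_Mapping.lookup \<gamma> i + 1)) (Poly_Mapping.lookup \<beta> i)) *
     Poly_Mapping.lookup p (\<gamma> + \<beta>)"
proof -
  interpret comp_fun_commute "\<lambda>i. pderiv_var i ^^ Poly_Mapping.lookup \<beta> i"
    by (rule comp_fun_commute_pderiv)
  have *: "Poly_Mapping.lookup
        (Finite_Set.fold (\<lambda>i. pderiv_var i ^^ Poly_Mapping.lookup \<beta> i) p A) \<gamma> =
      (\<Prod>i\<in>A. pochhammer (of_nat (Poly_Mapping.lookup \<gamma> i + 1)) (Poly_Mapping.lookup \<beta> i)) *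
      Poly_Mapping.lookup p (\<gamma> + (\<Sum>i\<in>A. Poly_Mapping.single i (Poly_Mapping.lookup \<beta> i)))"
    if "finite A" for A
    using that
  proof (induction A arbitrary: \<gamma>)
    case (insert x A)
    have "Poly_Mapping.lookup (\<gamma> + Poly_Mapping.single x (Poly_Mapping.lookup \<beta> x)) i =
        Poly_Mapping.lookup \<gamma> i" if "i \<in> A" for i
      using insert.hyps that by (auto simp: lookup_add lookup_single when_def)
    then show ?case
      using insert by (simp add: lookup_pderiv_var_funpow add_ac mult_ac)
  qed simp
  have "(\<Sum>i\<in>UNIV. Poly_Mapping.single i (Poly_Mapping.lookup \<beta> i)) = \<beta>"
    by (intro poly_mapping_eqI) (simp add: lookup_sum lookup_single when_def sum.delta)
  with *[of UNIV] show ?thesis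
    by (simp add: mderiv_def)
qed

lemma mderiv_single_self:
  obtains c where "c \<noteq> 0" "mderiv \<beta> (Poly_Mapping.single \<beta> 1) = mconst c"
proof
  let ?c = "\<Prod>i\<in>UNIV. pochhammer (1::complex) (Poly_Mapping.lookup \<beta> i)"
  show "?c \<noteq> 0" by (simp add: pochhammer_fact [symmetric])
  show "mderiv \<beta> (Poly_Mapping.single \<beta> 1) = mconst ?c"
    by (intro poly_mapping_eqI) (auto simp: lookup_mderiv mconst_def lookup_single when_def)
qed

lemma mpow_mvar: "mpow mvar \<alpha> = Poly_Mapping.single \<alpha> 1"
proof -
  have 1: "mvar i ^ k = Poly_Mapping.single (Poly_Mapping.single i k) 1" for i :: 'a and k
    by (induction k) (simp_all add: mvar_def mult_single flip: single_add)
  have "(\<Prod>i\<in>A. mvar i ^ Poly_Mapping.lookup \<alpha> i) =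
      Poly_Mapping.single (\<Sum>i\<in>A. Poly_Mapping.single i (Poly_Mapping.lookup \<alpha> i)) 1"
    if "finite A" for A
    using that by induction (simp_all add: 1 mult_single)
  moreover have "(\<Sum>i\<in>UNIV. Poly_Mapping.single i (Poly_Mapping.lookup \<alpha> i)) = \<alpha>"
    by (intro poly_mapping_eqI) (simp add: lookup_sum lookup_single when_def sum.delta)
  ultimately show ?thesis by (simp add: mpow_def)
qed

lemma weyl_op_superset:
  assumes "finite A" "Poly_Mapping.keys a \<subseteq> A"
  shows "weyl_op a p =
     (\<Sum>(\<alpha>, \<beta>)\<in>A. mconst (Poly_Mapping.lookup a (\<alpha>, \<beta>)) * mpow mvar \<alpha> * mderiv \<beta> p)"
  unfolding weyl_op_def using assms
  by (intro sum.mono_neutral_left) (auto simp: in_keys_iff mconst_def)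

lemma weyl_op_diff: "weyl_op (a - b) p = weyl_op a p - weyl_op b p"
proof -
  let ?A = "Poly_Mapping.keys a \<union> Poly_Mapping.keys b"
  have "Poly_Mapping.keys (a - b) \<subseteq> ?A"
    by (auto simp: in_keys_iff lookup_minus)
  then show ?thesis
    by (simp add: weyl_op_superset[of ?A] sum_subtractf [symmetric] lookup_minus mconst_def
        single_diff algebra_simps case_prod_unfold)
qed

lemma weyl_op_eq_0:
  assumes "weyl_op a = (\<lambda>p. 0)"
  shows "a = 0"
proof (rule ccontr)
  assume "a \<noteq> 0"
  define deg where "deg = (\<lambda>\<beta> :: 'a \<Rightarrow>\<^sub>0 nat. \<Sum>i\<in>UNIV. Poly_Mapping.lookup \<beta> i)"
  from \<open>a \<noteq> 0\<close> have "\<exists>x. x \<in> Poly_Mapping.keys a"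
    by (metis in_keys_iff lookup_zero poly_mapping_eqI)
  from ex_has_least_nat[of "\<lambda>x. x \<in> Poly_Mapping.keys a", of _ "\<lambda>x. deg (snd x)"] this
  obtain \<alpha>0 \<beta>0 where in_keys: "(\<alpha>0, \<beta>0) \<in> Poly_Mapping.keys a"
    and least: "\<And>\<alpha> \<beta>. (\<alpha>, \<beta>) \<in> Poly_Mapping.keys a \<Longrightarrow> deg \<beta>0 \<le> deg \<beta>"
    by (metis prod.collapse snd_conv)
  obtain c where c: "c \<noteq> 0" "mderiv \<beta>0 (Poly_Mapping.single \<beta>0 1) = mconst c"
    by (rule mderiv_single_self)
  have vanish: "mderiv \<beta> (Poly_Mapping.single \<beta>0 1) = 0"
    if "(\<alpha>, \<beta>) \<in> Poly_Mapping.keys a" "\<beta> \<noteq> \<beta>0" for \<alpha> \<beta>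
  proof (rule poly_mapping_eqI)
    fix \<gamma>
    have "\<gamma> + \<beta> \<noteq> \<beta>0"
    proof
      assume eq: "\<gamma> + \<beta> = \<beta>0"
      have "deg \<gamma> + deg \<beta> = deg \<beta>0"
        unfolding eq[symmetric] by (simp add: deg_def lookup_add sum.distrib)
      with least[OF that(1)] have "deg \<gamma> = 0" by simp
      then have "\<gamma> = 0" by (intro poly_mapping_eqI) (simp add: deg_def)
      with eq that show False by simp
    qed
    then show "Poly_Mapping.lookup (mderiv \<beta> (Poly_Mapping.single \<beta>0 1)) \<gamma> =
        Poly_Mapping.lookup 0 \<gamma>"
      by (simp add: lookup_mderiv lookup_single when_def)
  qed
  have "0 = Poly_Mapping.lookup (weyl_op a (Poly_Mapping.single \<beta>0 1)) \<alpha>0"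
    using assms by simp
  also have "\<dots> = (\<Sum>x\<in>Poly_Mapping.keys a.
      if x = (\<alpha>0, \<beta>0) then Poly_Mapping.lookup a (\<alpha>0, \<beta>0) * c else 0)"
    unfolding weyl_op_def lookup_sum
  proof (intro sum.cong refl, clarify)
    fix \<alpha> \<beta> assume "(\<alpha>, \<beta>) \<in> Poly_Mapping.keys a"
    then show "Poly_Mapping.lookup (mconst (Poly_Mapping.lookup a (\<alpha>, \<beta>)) * mpow mvar \<alpha> *
          mderiv \<beta> (Poly_Mapping.single \<beta>0 1)) \<alpha>0 =
        (if (\<alpha>, \<beta>) = (\<alpha>0, \<beta>0) then Poly_Mapping.lookup a (\<alpha>0, \<beta>0) * c else 0)"
      by (cases "\<beta> = \<beta>0")
        (auto simp: c vanish mpow_mvar mconst_def mult_single lookup_single when_def)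
  qed
  also have "\<dots> = Poly_Mapping.lookup a (\<alpha>0, \<beta>0) * c"
    using in_keys by (simp add: sum.delta)
  finally show False
    using in_keys c by (simp add: in_keys_iff)
qed

lemma inj_weyl_op: "inj weyl_op"
proof (rule injI)
  fix a b :: "('a \<Rightarrow>\<^sub>0 nat) \<times> ('a \<Rightarrow>\<^sub>0 nat) \<Rightarrow>\<^sub>0 complex"
  assume "weyl_op a = weyl_op b"
  then have "weyl_op (a - b) = (\<lambda>p. 0)" by (auto simp: weyl_op_diff)
  then have "a - b = 0" by (rule weyl_op_eq_0)
  then show "a = b" by simp
qed

lemma weyl_coeffs_weyl_op: "weyl_coeffs (weyl_op a) = a"
  unfolding weyl_coeffs_def using inj_weyl_op by (auto dest: injD)

end

theory Submission
  imports Defs "HOL-Computational_Algebra.Fundamental_Theorem_Algebra" "HOL-Analysis.Convex"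
begin

text \<open>
  Fix \<open>z\<close> in the closed upper half-space. Then \<open>(T f)(z)\<close> arises from \<open>F\<^sub>T(z, -w) f(\<zeta>)\<close>, which has
  no zeros for \<open>\<zeta>, w\<close> in the closed upper half-space, by replacing \<open>w\<^sub>i\<close> with \<open>-\<partial>/\<partial>\<zeta>\<^sub>i\<close> and setting
  \<open>\<zeta> = z\<close>. The pairs \<open>(\<zeta>\<^sub>i, w\<^sub>i)\<close> can be contracted one at a time with all other variables frozen, so
  it suffices that the contraction of a polynomial \<open>G(x, w)\<close> in two variables preserves the absence
  of zeros. This goes by induction on the degree \<open>m\<close> of \<open>G\<close> in \<open>w\<close>: by Laguerre's theorem the polar
  derivative \<open>m G + (a - w) \<partial>\<^sub>w G\<close>, of degree less than \<open>m\<close> in \<open>w\<close>, has no zeros for \<open>x, w, a\<close> in the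
  closed upper half-plane, and as it is affine in \<open>a\<close>, the substitution \<open>a \<mapsto> -\<partial>\<^sub>x\<close> is the degree-one
  case (the Lieb--Sokal lemma).
\<close>

section \<open>One-variable polynomials without zeros in the closed upper half-plane\<close>

lemma log_pderiv_prod:
  fixes r :: "'i \<Rightarrow> 'a::field"
  assumes "finite I" "\<And>i. i \<in> I \<Longrightarrow> w \<noteq> r i"
  shows "poly (pderiv (\<Prod>i\<in>I. [:- r i, 1:])) w =
           poly (\<Prod>i\<in>I. [:- r i, 1:]) w * (\<Sum>i\<in>I. 1 / (w - r i))"
  using assms
proof (induction I)
  case empty
  then show ?case by (simp add: pderiv_1)
next
  case (insert i I)
  then have nz: "w - r i \<noteq> 0" by auto
  let ?P = "\<Prod>j\<in>I. [:- r j, 1:]"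
  have "poly (pderiv (\<Prod>j\<in>insert i I. [:- r j, 1:])) w =
      (w - r i) * poly (pderiv ?P) w + poly ?P w"
    using insert.hyps by (simp add: pderiv_mult pderiv_pCons del: mult_pCons_left)
  also have "\<dots> = (w - r i) * (poly ?P w * (\<Sum>j\<in>I. 1 / (w - r j))) + poly ?P w"
    using insert by simp
  also have "\<dots> = (w - r i) * poly ?P w * (1 / (w - r i) + (\<Sum>j\<in>I. 1 / (w - r j)))"
    using nz by (simp add: field_simps)
  finally show ?case
    using insert.hyps by (simp add: left_diff_distrib)
qed

text \<open>
  Each \<open>u = 1 / (w - r)\<close> with \<open>Im r < 0\<close> satisfies \<open>Im w |u|\<^sup>2 + Im u < 0\<close>; the left-hand side is convex
  in \<open>u\<close> and vanishes at \<open>0\<close>, so the bound passes to the average \<open>L / m\<close> of the \<open>1 / (w - r)\<close>, padded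
  with zeros.
\<close>

lemma im_log_pderiv:
  fixes h :: "complex poly"
  assumes stable: "\<And>w. Im w \<ge> 0 \<Longrightarrow> poly h w \<noteq> 0"
    and w: "Im w \<ge> 0" and deg: "degree h \<le> m"
  defines "L \<equiv> poly (pderiv h) w / poly h w"
  assumes "L \<noteq> 0"
  shows "Im w * (cmod L)\<^sup>2 + real m * Im L < 0"
proof -
  let ?d = "degree h"
  obtain r where r: "smult (lead_coeff h) (\<Prod>i<?d. [:- r i, 1:]) = h"
    by (rule complex_poly_decompose')
  have "h \<noteq> 0" using stable[OF w] by auto
  have "poly h (r i) = 0" if "i < ?d" for i
    using that by (subst r [symmetric]) (auto simp: poly_prod)
  then have im_r: "Im (r i) < 0" if "i < ?d" for i
    using that stable[of "r i"] by force
  then have nz: "w \<noteq> r i" if "i < ?d" for i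
    using that w by force
  define u where "u i = 1 / (w - r i)" for i
  have L: "L = (\<Sum>i<?d. u i)"
  proof -
    have "poly (pderiv h) w = lead_coeff h * poly (pderiv (\<Prod>i<?d. [:- r i, 1:])) w"
      by (subst r [symmetric]) (simp add: pderiv_smult)
    also have "\<dots> = lead_coeff h * poly (\<Prod>i<?d. [:- r i, 1:]) w * (\<Sum>i<?d. 1 / (w - r i))"
      using nz by (subst log_pderiv_prod) auto
    also have "lead_coeff h * poly (\<Prod>i<?d. [:- r i, 1:]) w = poly h w"
      by (subst (3) r [symmetric]) simp
    finally show ?thesis
      using stable[OF w] by (simp add: L_def u_def)
  qed
  have u: "Im w * (cmod (u i))\<^sup>2 + Im (u i) < 0" if "i < ?d" for i
  proof -
    have "cmod (w - r i) > 0" using nz[OF that] by simp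
    moreover have "Im (u i) = - (Im w - Im (r i)) / (cmod (w - r i))\<^sup>2"
      by (simp add: u_def Im_divide cmod_def)
    then have "Im w * (cmod (u i))\<^sup>2 + Im (u i) = Im (r i) / (cmod (w - r i))\<^sup>2"
      by (simp add: u_def norm_divide power_divide diff_divide_distrib add_divide_distrib)
    ultimately show ?thesis
      using im_r[OF that] by (simp add: divide_neg_pos)
  qed
  have "?d \<noteq> 0"
    using \<open>L \<noteq> 0\<close> by (intro notI) (simp add: L)
  \<comment> \<open>Convexity enters as the Cauchy-Schwarz inequality over the \<open>?d\<close>
    roots.\<close>
  have "(cmod L)\<^sup>2 \<le> (\<Sum>i<?d. cmod (u i))\<^sup>2"
    unfolding L by (intro power_mono norm_sum) auto
  also have "\<dots> \<le> (\<Sum>i<?d. (cmod (u i))\<^sup>2) * real ?d"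
    using sum_squared_le_sum_of_squares[of "\<lambda>i. cmod (u i)" "{..<?d}"] by simp
  finally have "Im w * (cmod L)\<^sup>2 \<le> Im w * ((\<Sum>i<?d. (cmod (u i))\<^sup>2) * real ?d)"
    using w by (intro mult_left_mono)
  then have "Im w * (cmod L)\<^sup>2 + real ?d * Im L \<le>
      real ?d * (\<Sum>i<?d. Im w * (cmod (u i))\<^sup>2 + Im (u i))"
    by (simp add: L sum.distrib sum_distrib_left algebra_simps)
  also have "\<dots> < 0"
  proof -
    have "(\<Sum>i<?d. Im w * (cmod (u i))\<^sup>2 + Im (u i)) < (\<Sum>i<?d. 0)"
      using u \<open>?d \<noteq> 0\<close> by (intro sum_strict_mono) auto
    then show ?thesis
      using \<open>?d \<noteq> 0\<close> by (simp add: mult_pos_neg)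
  qed
  finally have neg: "Im w * (cmod L)\<^sup>2 + real ?d * Im L < 0" .
  \<comment> \<open>Padding with zeros amounts to replacing \<open>?d\<close> by \<open>m\<close>,
    which preserves the bound because \<open>Im L < 0\<close>.\<close>
  with w have "real ?d * Im L < 0"
    by (smt (verit) mult_nonneg_nonneg zero_le_power2)
  then have "Im L < 0"
    by (simp add: mult_less_0_iff)
  then have "real m * Im L \<le> real ?d * Im L"
    using deg by (intro mult_right_mono_neg) auto
  with neg show ?thesis by simp
qed

text \<open>In \<open>im_log_pderiv\<close> the term \<open>Im w * (cmod L)\<^sup>2\<close> is
  nonnegative, which leaves \<open>Im L < 0\<close>. The weak inequality also covers constant
  \<open>h\<close>, where the quotient is \<open>0\<close>.\<close>

lemma im_log_pderiv_nonpos: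
  fixes h :: "complex poly"
  assumes "\<And>w. Im w \<ge> 0 \<Longrightarrow> poly h w \<noteq> 0" and "Im w \<ge> 0"
  shows "Im (poly (pderiv h) w / poly h w) \<le> 0"
proof (cases "poly (pderiv h) w / poly h w = 0")
  case True
  then show ?thesis by (simp only: zero_complex.sel)
next
  case False
  let ?L = "poly (pderiv h) w / poly h w"
  have "Im w * (cmod ?L)\<^sup>2 + real (degree h) * Im ?L < 0"
    using False assms by (intro im_log_pderiv) auto
  moreover have "0 \<le> Im w * (cmod ?L)\<^sup>2"
    using assms(2) by simp
  ultimately have "real (degree h) * Im ?L < 0" by linarith
  then show ?thesis by (simp add: mult_less_0_iff)
qed

text \<open>Laguerre's theorem. A zero would give \<open>a = w - m / L\<close> with
  \<open>L = h'(w) / h(w)\<close>, so that \<open>Im a * (cmod L)\<^sup>2\<close> is the quantity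
  that \<open>im_log_pderiv\<close> shows to be negative.\<close>

lemma polar_derivative_nonzero:
  fixes h :: "complex poly"
  assumes stable: "\<And>w. Im w \<ge> 0 \<Longrightarrow> poly h w \<noteq> 0"
    and "degree h \<le> m" "m > 0" "Im w \<ge> 0" "Im a \<ge> 0"
  shows "of_nat m * poly h w + (a - w) * poly (pderiv h) w \<noteq> 0"
proof
  assume eq: "of_nat m * poly h w + (a - w) * poly (pderiv h) w = 0"
  define L where "L = poly (pderiv h) w / poly h w"
  have h: "poly h w \<noteq> 0" using stable assms by blast
  have eq': "(w - a) * L = of_nat m"
    using eq h by (simp add: L_def field_simps)
  with \<open>m > 0\<close> have "L \<noteq> 0" by auto
  have "Im w * (cmod L)\<^sup>2 + real m * Im L < 0"
    using \<open>L \<noteq> 0\<close> assms unfolding L_def by (intro im_log_pderiv) auto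
  moreover have "Im w * (cmod L)\<^sup>2 + real m * Im L = Im a * (cmod L)\<^sup>2"
  proof -
    have "of_nat m * cnj L = (w - a) * of_real ((cmod L)\<^sup>2)"
      unfolding eq' [symmetric] by (simp add: complex_norm_square mult_ac del: of_real_power)
    then have "Im (of_nat m * cnj L) = Im ((w - a) * of_real ((cmod L)\<^sup>2))"
      by (rule arg_cong)
    then show ?thesis
      by (simp add: algebra_simps)
  qed
  ultimately have "Im a * (cmod L)\<^sup>2 < 0" by simp
  with \<open>Im a \<ge> 0\<close> show False
    by (smt (verit) mult_nonneg_nonneg zero_le_power2)
qed

text \<open>If \<open>P x = Q' x\<close>, the logarithmic derivative of \<open>P + a Q\<close> at
  \<open>x\<close> is \<open>(P' + a P) / (P + a Q)\<close>, with imaginary part at most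
  \<open>0\<close>. For large imaginary \<open>a\<close> it approaches \<open>P / Q\<close>, or is
  \<open>P' / P + a\<close> if \<open>Q x = 0\<close>.\<close>

lemma lieb_sokal:
  fixes P Q :: "complex poly"
  assumes stable: "\<And>x a. Im x \<ge> 0 \<Longrightarrow> Im a \<ge> 0 \<Longrightarrow> poly P x + a * poly Q x \<noteq> 0"
    and x: "Im x \<ge> 0"
  shows "poly P x \<noteq> poly (pderiv Q) x"
proof
  assume eq: "poly P x = poly (pderiv Q) x"
  have P: "poly P x \<noteq> 0" using stable[of x 0] x by simp
  have le: "Im ((poly (pderiv P) x + a * poly P x) / (poly P x + a * poly Q x)) \<le> 0"
    if "Im a \<ge> 0" for a
  proof -
    have "Im (poly (pderiv (P + smult a Q)) x / poly (P + smult a Q) x) \<le> 0"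
      by (intro im_log_pderiv_nonpos) (use stable that x in auto)
    then show ?thesis
      by (simp add: pderiv_add pderiv_smult eq)
  qed
  \<comment> \<open>contradicted by \<open>a = \<i> t\<close> as \<open>t \<rightarrow> \<infinity>\<close>\<close>
  show False
  proof (cases "poly Q x = 0")
    case True
    define t where "t = \<bar>Im (poly (pderiv P) x / poly P x)\<bar> + 1"
    have "Im (poly (pderiv P) x / poly P x) + t \<le> 0"
      using le[of "\<i> * of_real t"] P True
      by (simp add: t_def add_divide_distrib)
    then show False by (simp add: t_def)
  next
    case False
    \<comment> \<open>\<open>- P / Q\<close> is the zero of \<open>P + a Q\<close> in
      \<open>a\<close>, so it lies in the open lower half-plane.\<close>
    have "Im (- (poly P x / poly Q x)) < 0"
      using stable[of x "- (poly P x / poly Q x)"] False x by force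
    then have "Im (poly P x / poly Q x) > 0" by simp
    moreover have "Im (poly P x / poly Q x) \<le> 0"
    proof (rule tendsto_upperbound)
      \<comment> \<open>For \<open>a = \<i> (n + 1)\<close>, multiplying numerator and denominator
        by \<open>1 / a = - \<i> * s n\<close> turns the limit at infinity into continuity at
        \<open>0\<close>.\<close>
      define s :: "nat \<Rightarrow> complex" where "s n = inverse (of_nat (Suc n))" for n
      have s: "s \<longlonglongrightarrow> 0"
        unfolding s_def
        using tendsto_of_real[OF LIMSEQ_inverse_real_of_nat, where 'a = complex]
        by (simp del: of_nat_Suc)
      show "(\<lambda>n. Im ((- \<i> * s n * poly (pderiv P) x + poly P x) /
                (- \<i> * s n * poly P x + poly Q x))) \<longlonglongrightarrow> Im (poly P x / poly Q x)"
        using False by (auto intro!: tendsto_eq_intros s)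
      show "\<forall>\<^sub>F n in sequentially. Im ((- \<i> * s n * poly (pderiv P) x + poly P x) /
                (- \<i> * s n * poly P x + poly Q x)) \<le> 0"
      proof (intro always_eventually allI)
        fix n
        have scale: "\<i> * of_nat (Suc n) * (- \<i> * s n * X + Y) = X + \<i> * of_nat (Suc n) * Y" for X Y
          by (simp add: s_def field_simps del: of_nat_Suc)
        have "(- \<i> * s n * poly (pderiv P) x + poly P x) / (- \<i> * s n * poly P x + poly Q x) =
            (\<i> * of_nat (Suc n) * (- \<i> * s n * poly (pderiv P) x + poly P x)) /
            (\<i> * of_nat (Suc n) * (- \<i> * s n * poly P x + poly Q x))"
          by (subst mult_divide_mult_cancel_left) (simp_all del: of_nat_Suc)
        also have "\<dots> = (poly (pderiv P) x + \<i> * of_nat (Suc n) * poly P x) /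
            (poly P x + \<i> * of_nat (Suc n) * poly Q x)"
          unfolding scale ..
        finally show "Im ((- \<i> * s n * poly (pderiv P) x + poly P x) /
                (- \<i> * s n * poly P x + poly Q x)) \<le> 0"
          using le[of "\<i> * of_nat (Suc n)"] by (simp del: of_nat_Suc)
      qed
    qed auto
    ultimately show False by simp
  qed
qed

section \<open>Contraction of one pair of variables\<close>

lemma pderiv_sum: "pderiv (sum f A) = (\<Sum>x\<in>A. pderiv (f x))"
  using higher_pderiv_sum[of 1] by simp

text \<open>Here \<open>g k\<close> is the coefficient of \<open>w ^ k\<close> in
  \<open>G(x, w)\<close>. Each polar derivative lowers the degree bound \<open>m\<close> by
  one.\<close>

lemma contraction_nonzero:
  fixes g :: "nat \<Rightarrow> complex poly"
  assumes "\<And>x w. Im x \<ge> 0 \<Longrightarrow> Im w \<ge> 0 \<Longrightarrow> (\<Sum>k\<le>m. w ^ k * poly (g k) x) \<noteq> 0"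
    and x: "Im x \<ge> 0"
  shows "(\<Sum>k\<le>m. (-1) ^ k * poly ((pderiv ^^ k) (g k)) x) \<noteq> 0"
  using assms(1)
proof (induction m arbitrary: g)
  case 0
  from 0[of x 0] x show ?case by simp
next
  case (Suc m)
  let ?n = "of_nat (Suc m) :: complex"
  \<comment> \<open>the coefficients in \<open>w\<close> of the polar derivative with \<open>a\<close> replaced by \<open>-\<partial>\<^sub>x\<close>; their contraction
    is \<open>m + 1\<close> times that of \<open>g\<close>\<close>
  define g' where "g' k = smult (?n - of_nat k) (g k) + smult (- of_nat (Suc k)) (pderiv (g (Suc k)))" for k
  have "(\<Sum>k\<le>m. w ^ k * poly (g' k) x) \<noteq> 0" if xw: "Im x \<ge> 0" "Im w \<ge> 0" for x w
  proof -
    \<comment> \<open>At fixed \<open>w\<close>, the polar derivative is \<open>P + a Q\<close> as a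
      polynomial in \<open>x\<close>. The sum for \<open>P\<close> stops at \<open>m\<close> because
      the factor \<open>?n - of_nat k\<close> vanishes at \<open>k = Suc m\<close>.\<close>
    define P where "P = (\<Sum>k\<le>m. smult (w ^ k * (?n - of_nat k)) (g k))"
    define Q where "Q = (\<Sum>k\<le>m. smult (w ^ k * of_nat (Suc k)) (g (Suc k)))"
    have "poly P x + a * poly Q x \<noteq> 0" if xa: "Im x \<ge> 0" "Im a \<ge> 0" for x a
    proof -
      \<comment> \<open>Laguerre's theorem is applied in \<open>w\<close> at fixed \<open>x\<close>;
        the Lieb-Sokal lemma is then applied in \<open>x\<close> at fixed \<open>w\<close>.\<close>
      define h where "h = (\<Sum>k\<le>Suc m. monom (poly (g k) x) k)"
      have h: "poly h w = (\<Sum>k\<le>Suc m. w ^ k * poly (g k) x)" for w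
        by (simp add: h_def poly_sum poly_monom mult.commute del: sum.atMost_Suc)
      have "?n * poly h w + (a - w) * poly (pderiv h) w \<noteq> 0"
      proof (rule polar_derivative_nonzero)
        show "degree h \<le> Suc m"
          unfolding h_def by (intro degree_sum_le) (auto intro: order.trans[OF degree_monom_le])
      qed (use Suc.prems xa xw in \<open>auto simp: h simp del: sum.atMost_Suc\<close>)
      moreover have h': "poly (pderiv h) w = poly Q x"
        unfolding h_def pderiv_sum poly_sum pderiv_monom poly_monom Q_def
        by (subst sum.atMost_Suc_shift) (simp add: mult_ac)
      moreover have "w * poly (pderiv h) w = (\<Sum>k\<le>Suc m. of_nat k * (w ^ k * poly (g k) x))"
        unfolding h' Q_def poly_sum
        by (subst sum.atMost_Suc_shift) (simp add: sum_distrib_left mult_ac)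
      then have "?n * poly h w - w * poly (pderiv h) w =
          (\<Sum>k\<le>Suc m. (?n - of_nat k) * (w ^ k * poly (g k) x))"
        by (simp only: h sum_distrib_left sum_subtractf left_diff_distrib)
      then have "?n * poly h w - w * poly (pderiv h) w = poly P x"
        by (simp add: P_def poly_sum mult_ac)
      then have "poly P x + a * poly Q x = ?n * poly h w + (a - w) * poly (pderiv h) w"
        unfolding h' [symmetric] by (simp add: algebra_simps del: of_nat_Suc)
      ultimately show ?thesis by simp
    qed
    then have "poly P x \<noteq> poly (pderiv Q) x"
      using xw by (intro lieb_sokal) auto
    moreover have "(\<Sum>k\<le>m. w ^ k * poly (g' k) x) = poly P x - poly (pderiv Q) x"
      by (simp add: g'_def P_def Q_def pderiv_sum poly_sum pderiv_smult sum_subtractf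
          right_diff_distrib mult_ac del: of_nat_Suc)
    ultimately show ?thesis by simp
  qed
  then have "(\<Sum>k\<le>m. (-1) ^ k * poly ((pderiv ^^ k) (g' k)) x) \<noteq> 0"
    by (rule Suc.IH)
  also have "(\<Sum>k\<le>m. (-1) ^ k * poly ((pderiv ^^ k) (g' k)) x) =
      ?n * (\<Sum>k\<le>Suc m. (-1) ^ k * poly ((pderiv ^^ k) (g k)) x)"
  proof -
    \<comment> \<open>\<open>t k\<close> occurs with factor \<open>?n - k\<close> from
      \<open>g' k\<close> and with factor \<open>k\<close> from \<open>g' (k - 1)\<close>, hence
      \<open>?n\<close> in total. The boundary terms have factor \<open>0\<close>.\<close>
    define t where "t k = (-1) ^ k * poly ((pderiv ^^ k) (g k)) x" for k
    have "(-1) ^ k * poly ((pderiv ^^ k) (g' k)) x =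
        (?n - of_nat k) * t k + of_nat (Suc k) * t (Suc k)" for k
      unfolding g'_def higher_pderiv_add higher_pderiv_smult
      by (simp add: t_def funpow_swap1 algebra_simps del: of_nat_Suc)
    then have "(\<Sum>k\<le>m. (-1) ^ k * poly ((pderiv ^^ k) (g' k)) x) =
        (\<Sum>k\<le>m. (?n - of_nat k) * t k) + (\<Sum>k\<le>m. of_nat (Suc k) * t (Suc k))"
      by (simp add: sum.distrib)
    also have "(\<Sum>k\<le>m. (?n - of_nat k) * t k) = (\<Sum>k\<le>Suc m. (?n - of_nat k) * t k)"
      by simp
    also have "(\<Sum>k\<le>m. of_nat (Suc k) * t (Suc k)) = (\<Sum>k\<le>Suc m. of_nat k * t k)"
      by (subst sum.atMost_Suc_shift) simp
    finally show ?thesis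
      by (simp add: sum_distrib_left t_def algebra_simps flip: sum.distrib del: sum.atMost_Suc)
  qed
  finally show ?case by simp
qed

text \<open>Collecting the terms with equal exponent gives the coefficients \<open>g k\<close> of
  \<open>contraction_nonzero\<close>. Many terms of a symbol may share the same exponent in one
  variable.\<close>

lemma contraction_nonzero_family:
  fixes p :: "'k \<Rightarrow> complex poly"
  assumes "finite K" and x: "Im x \<ge> 0"
    and stable: "\<And>x w. Im x \<ge> 0 \<Longrightarrow> Im w \<ge> 0 \<Longrightarrow> (\<Sum>y\<in>K. w ^ e y * poly (p y) x) \<noteq> 0"
  shows "(\<Sum>y\<in>K. (-1) ^ e y * poly ((pderiv ^^ e y) (p y)) x) \<noteq> 0"
proof -
  define m where "m = (\<Sum>y\<in>K. e y)"
  have m: "e ` K \<subseteq> {..m}"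
    using \<open>finite K\<close> by (auto simp: m_def intro: member_le_sum)
  define g where "g k = (\<Sum>y | y \<in> K \<and> e y = k. p y)" for k
  have "(\<Sum>k\<le>m. w ^ k * poly (g k) x) = (\<Sum>y\<in>K. w ^ e y * poly (p y) x)" for w x
    unfolding sum.group[OF \<open>finite K\<close> finite_atMost m, symmetric]
    by (auto simp: g_def poly_sum sum_distrib_left intro!: sum.cong)
  with stable have "(\<Sum>k\<le>m. (-1) ^ k * poly ((pderiv ^^ k) (g k)) x) \<noteq> 0"
    by (intro contraction_nonzero x) auto
  also have "(\<Sum>k\<le>m. (-1) ^ k * poly ((pderiv ^^ k) (g k)) x) =
      (\<Sum>y\<in>K. (-1) ^ e y * poly ((pderiv ^^ e y) (p y)) x)"
    unfolding sum.group[OF \<open>finite K\<close> finite_atMost m, symmetric]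
    by (auto simp: g_def higher_pderiv_sum poly_sum sum_distrib_left intro!: sum.cong)
  finally show ?thesis .
qed

section \<open>Evaluation of multivariate polynomials and restriction to one variable\<close>

lemma mpoly_eval_superset:
  assumes "finite A" "Poly_Mapping.keys p \<subseteq> A"
  shows "mpoly_eval p z = (\<Sum>\<alpha>\<in>A. Poly_Mapping.lookup p \<alpha> * mpow z \<alpha>)"
  unfolding mpoly_eval_def using assms
  by (intro sum.mono_neutral_left) (auto simp: in_keys_iff)

lemma mpoly_eval_0 [simp]: "mpoly_eval 0 z = 0"
  by (simp add: mpoly_eval_def)

lemma mpoly_eval_add: "mpoly_eval (p + q) z = mpoly_eval p z + mpoly_eval q z"
proof -
  let ?A = "Poly_Mapping.keys p \<union> Poly_Mapping.keys q"
  have "mpoly_eval (p + q) z = (\<Sum>\<alpha>\<in>?A. Poly_Mapping.lookup (p + q) \<alpha> * mpow z \<alpha>)"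
    by (intro mpoly_eval_superset keys_add) auto
  then show ?thesis
    by (simp add: mpoly_eval_superset[of ?A] lookup_add sum.distrib distrib_right)
qed

lemma mpoly_eval_sum: "mpoly_eval (sum f A) z = (\<Sum>x\<in>A. mpoly_eval (f x) z)"
  by (induction A rule: infinite_finite_induct) (simp_all add: mpoly_eval_add)

lemma mpoly_eval_uminus: "mpoly_eval (- p) z = - mpoly_eval p z"
  using mpoly_eval_add[of p "- p" z] by (simp add: eq_neg_iff_add_eq_0 add.commute)

lemma mpoly_eval_single: "mpoly_eval (Poly_Mapping.single \<alpha> c) z = c * mpow z \<alpha>"
  by (simp add: mpoly_eval_def)

lemma mpow_0 [simp]: "mpow x 0 = 1"
  by (simp add: mpow_def)

lemma mpow_add: "mpow x (\<alpha> + \<beta>) = mpow x \<alpha> * mpow x \<beta>"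
  by (simp add: mpow_def lookup_add power_add prod.distrib)

lemma mpow_single: "mpow x (Poly_Mapping.single i k) = x i ^ k"
proof -
  have "mpow x (Poly_Mapping.single i k) = (\<Prod>j\<in>UNIV. if j = i then x j ^ k else 1)"
    unfolding mpow_def by (intro prod.cong) (auto simp: lookup_single when_def)
  then show ?thesis by (simp add: prod.delta)
qed

lemma mpoly_eval_mult: "mpoly_eval (p * q) z = mpoly_eval p z * mpoly_eval q z"
proof -
  have expand: "r = (\<Sum>\<alpha>\<in>Poly_Mapping.keys r. Poly_Mapping.single \<alpha> (Poly_Mapping.lookup r \<alpha>))"
    for r :: "'a mpoly"
    by (intro poly_mapping_eqI) (simp add: lookup_sum lookup_single when_def in_keys_iff)
  have "p * q = (\<Sum>\<alpha>\<in>Poly_Mapping.keys p. \<Sum>\<beta>\<in>Poly_Mapping.keys q.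
      Poly_Mapping.single (\<alpha> + \<beta>) (Poly_Mapping.lookup p \<alpha> * Poly_Mapping.lookup q \<beta>))"
    by (subst expand[of p], subst expand[of q]) (simp only: sum_product mult_single)
  then show ?thesis
    by (simp add: mpoly_eval_sum mpoly_eval_single mpow_add)
      (simp add: mpoly_eval_def sum_product mult_ac)
qed

lemma mpoly_eval_mconst: "mpoly_eval (mconst c) z = c"
  by (simp add: mconst_def mpoly_eval_single)

lemma mpoly_eval_mvar: "mpoly_eval (mvar i) z = z i"
  by (simp add: mvar_def mpoly_eval_single mpow_single)

lemma mpoly_eval_1: "mpoly_eval 1 z = 1"
  using mpoly_eval_mconst[of 1 z] by (simp add: mconst_def)

lemma mpoly_eval_power: "mpoly_eval (p ^ k) z = mpoly_eval p z ^ k"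
  by (induction k) (simp_all add: mpoly_eval_1 mpoly_eval_mult)

lemma mpoly_eval_prod: "mpoly_eval (prod f A) z = (\<Prod>x\<in>A. mpoly_eval (f x) z)"
  by (induction A rule: infinite_finite_induct) (simp_all add: mpoly_eval_1 mpoly_eval_mult)

lemma mpoly_eval_mpow: "mpoly_eval (mpow s \<alpha>) z = mpow (\<lambda>i. mpoly_eval (s i) z) \<alpha>"
  by (simp add: mpow_def mpoly_eval_prod mpoly_eval_power)

lemma mpoly_eval_subst:
  "mpoly_eval (mpoly_subst p s) z = mpoly_eval p (\<lambda>i. mpoly_eval (s i) z)"
  by (simp add: mpoly_subst_def mpoly_eval_sum mpoly_eval_mult mpoly_eval_mconst mpoly_eval_mpow
      mpoly_eval_def[of p])

text \<open>Bridge from \<open>pderiv_var\<close> to the univariate \<open>pderiv\<close>; the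
  coordinates other than \<open>j\<close> are frozen at \<open>z\<close>.\<close>

definition restrict_var :: "'v::finite \<Rightarrow> ('v \<Rightarrow> complex) \<Rightarrow> 'v mpoly \<Rightarrow> complex poly" where
  "restrict_var j z p = (\<Sum>\<alpha>\<in>Poly_Mapping.keys p.
     monom (Poly_Mapping.lookup p \<alpha> * (\<Prod>i\<in>UNIV - {j}. z i ^ Poly_Mapping.lookup \<alpha> i))
       (Poly_Mapping.lookup \<alpha> j))"

lemma poly_restrict_var: "poly (restrict_var j z p) x = mpoly_eval p (z(j := x))"
proof -
  have "mpow (z(j := x)) \<alpha> =
      (\<Prod>i\<in>UNIV - {j}. z i ^ Poly_Mapping.lookup \<alpha> i) * x ^ Poly_Mapping.lookup \<alpha> j" for \<alpha>
    unfolding mpow_def by (subst prod.remove[of _ j]) (auto intro!: prod.cong)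
  then show ?thesis
    by (simp add: restrict_var_def mpoly_eval_def poly_sum poly_monom mult_ac)
qed

lemma pderiv_restrict_var: "pderiv (restrict_var j z p) = restrict_var j z (pderiv_var j p)"
proof -
  let ?e = "Poly_Mapping.single j (1::nat)"
  have "poly (pderiv (restrict_var j z p)) x = poly (restrict_var j z (pderiv_var j p)) x" for x
  proof -
    \<comment> \<open>For exponent \<open>0\<close> both subtractions are truncated, but the factor
      \<open>of_nat 0\<close> makes both sides vanish.\<close>
    have *: "(of_nat (Poly_Mapping.lookup \<alpha> j)) * mpow (z(j := x)) (\<alpha> - ?e) =
        (\<Prod>i\<in>UNIV - {j}. z i ^ Poly_Mapping.lookup \<alpha> i) *
        (of_nat (Poly_Mapping.lookup \<alpha> j) * x ^ (Poly_Mapping.lookup \<alpha> j - 1))" for \<alpha>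
      unfolding mpow_def
      by (subst prod.remove[of _ j]) 
        (auto simp: lookup_minus lookup_single when_def intro!: prod.cong)
    have "poly (pderiv (restrict_var j z p)) x = (\<Sum>\<alpha>\<in>Poly_Mapping.keys p. Poly_Mapping.lookup p \<alpha> *
        ((\<Prod>i\<in>UNIV - {j}. z i ^ Poly_Mapping.lookup \<alpha> i) *
        (of_nat (Poly_Mapping.lookup \<alpha> j) * x ^ (Poly_Mapping.lookup \<alpha> j - 1))))"
      by (simp add: restrict_var_def pderiv_sum pderiv_monom poly_sum poly_monom mult_ac)
    also have "\<dots> = (\<Sum>\<alpha>\<in>Poly_Mapping.keys p. Poly_Mapping.lookup p \<alpha> *
        (of_nat (Poly_Mapping.lookup \<alpha> j) * mpow (z(j := x)) (\<alpha> - ?e)))"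
      by (simp only: *)
    also have "\<dots> = poly (restrict_var j z (pderiv_var j p)) x"
      by (simp add: poly_restrict_var pderiv_var_def mpoly_eval_sum mpoly_eval_single mult_ac)
    finally show ?thesis .
  qed
  then show ?thesis by (simp add: poly_eq_poly_eq_iff [symmetric] fun_eq_iff)
qed

lemma higher_pderiv_restrict_var:
  "(pderiv ^^ k) (restrict_var j z p) = restrict_var j z ((pderiv_var j ^^ k) p)"
  by (induction k) (simp_all add: pderiv_restrict_var)

section \<open>Contraction of all pairs of variables\<close>

text \<open>Induction over the set \<open>S\<close> of contracted pairs: for \<open>i\<close> in
  \<open>S\<close> the variable \<open>- w i\<close> has become a derivative of \<open>f\<close>,
  and the other \<open>w i\<close> are still free. The point \<open>z\<close> is the argument of
  \<open>f\<close> only.\<close>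

lemma mixed_contraction_nonzero:
  fixes b :: "'k \<Rightarrow> ('n::finite \<Rightarrow>\<^sub>0 nat)" and z w :: "'n \<Rightarrow> complex"
  assumes "finite K"
    and symbol: "\<And>w. (\<And>i. Im (w i) \<ge> 0) \<Longrightarrow> (\<Sum>y\<in>K. c y * mpow (\<lambda>i. - w i) (b y)) \<noteq> 0"
    and f: "f \<in> strictly_stable_polys"
    and "finite S" and "\<And>i. Im (z i) \<ge> 0" and "\<And>i. Im (w i) \<ge> 0"
  shows "(\<Sum>y\<in>K. c y * (\<Prod>i\<in>- S. (- w i) ^ Poly_Mapping.lookup (b y) i) *
           mpoly_eval (Finite_Set.fold (\<lambda>i. pderiv_var i ^^ Poly_Mapping.lookup (b y) i) f S) z) \<noteq> 0"
  using assms(4-)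
proof (induction S arbitrary: z w)
  case empty
  then have "(\<Sum>y\<in>K. c y * mpow (\<lambda>i. - w i) (b y)) * mpoly_eval f z \<noteq> 0"
    using symbol f by (simp add: strictly_stable_polys_def)
  then show ?case
    by (simp add: mpow_def sum_distrib_right)
next
  case (insert j S)
  define D where "D y = Finite_Set.fold (\<lambda>i. pderiv_var i ^^ Poly_Mapping.lookup (b y) i) f S" for y
  define e where "e y = Poly_Mapping.lookup (b y) j" for y
  define C where "C y = c y * (\<Prod>i\<in>- insert j S. (- w i) ^ Poly_Mapping.lookup (b y) i)" for y
  \<comment> \<open>The sign turns \<open>v ^ e y\<close> into \<open>(- v) ^ e y\<close>; it
    cancels against the \<open>(-1) ^ e y\<close> of the contraction, leaving the plain
    derivative.\<close>
  define p where "p y = smult ((-1) ^ e y * C y) (restrict_var j z (D y))" for y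
  have fold_insert: "Finite_Set.fold (\<lambda>i. pderiv_var i ^^ Poly_Mapping.lookup (b y) i) f (insert j S) =
      (pderiv_var j ^^ e y) (D y)" for y
  proof -
    interpret comp_fun_commute "\<lambda>i. pderiv_var i ^^ Poly_Mapping.lookup (b y) i"
      by (rule comp_fun_commute_pderiv)
    show ?thesis
      using insert.hyps by (simp add: D_def e_def)
  qed
  have "(\<Sum>y\<in>K. (-1) ^ e y * poly ((pderiv ^^ e y) (p y)) (z j)) \<noteq> 0"
  proof (rule contraction_nonzero_family)
    fix x v :: complex
    assume "Im x \<ge> 0" "Im v \<ge> 0"
    \<comment> \<open>Before pair \<open>j\<close> is contracted, both of its variables range over
      the closed upper half-plane.\<close>
    then have "(\<Sum>y\<in>K. c y * (\<Prod>i\<in>- S. (- (w(j := v)) i) ^ Poly_Mapping.lookup (b y) i) *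
        mpoly_eval (D y) (z(j := x))) \<noteq> 0"
      unfolding D_def using insert.prems by (intro insert.IH) auto
    moreover have "c y * (\<Prod>i\<in>- S. (- (w(j := v)) i) ^ Poly_Mapping.lookup (b y) i) =
        v ^ e y * ((-1) ^ e y * C y)" for y
    proof -
      have "- S = insert j (- insert j S)" using insert.hyps by auto
      then have "(\<Prod>i\<in>- S. (- (w(j := v)) i) ^ Poly_Mapping.lookup (b y) i) =
          (- v) ^ e y * (\<Prod>i\<in>- insert j S. (- (w(j := v)) i) ^ Poly_Mapping.lookup (b y) i)"
        by (simp add: e_def)
      also have "(\<Prod>i\<in>- insert j S. (- (w(j := v)) i) ^ Poly_Mapping.lookup (b y) i) =
          (\<Prod>i\<in>- insert j S. (- w i) ^ Poly_Mapping.lookup (b y) i)"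
        by (intro prod.cong) auto
      finally show ?thesis
        by (simp add: C_def power_minus[of v] mult_ac)
    qed
    ultimately show "(\<Sum>y\<in>K. v ^ e y * poly (p y) x) \<noteq> 0"
      by (simp only: p_def poly_restrict_var poly_smult mult.assoc not_False_eq_True)
  qed (use \<open>finite K\<close> insert.prems in auto)
  also have "(\<Sum>y\<in>K. (-1) ^ e y * poly ((pderiv ^^ e y) (p y)) (z j)) =
      (\<Sum>y\<in>K. C y * mpoly_eval ((pderiv_var j ^^ e y) (D y)) z)"
    by (simp add: p_def higher_pderiv_smult higher_pderiv_restrict_var poly_restrict_var
        flip: mult.assoc power_mult_distrib)
  finally show ?case
    by (simp only: fold_insert C_def not_False_eq_True)
qed

section \<open>Weyl operators and their symbols\<close>

lemma mpoly_eval_weyl_op: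
  "mpoly_eval (weyl_op a f) z = (\<Sum>(\<alpha>, \<beta>)\<in>Poly_Mapping.keys a.
     Poly_Mapping.lookup a (\<alpha>, \<beta>) * mpow z \<alpha> * mpoly_eval (mderiv \<beta> f) z)"
  by (simp add: weyl_op_def mpoly_eval_sum mpoly_eval_mult mpoly_eval_mconst mpoly_eval_mpow
      mpoly_eval_mvar case_prod_unfold)

lemma mpoly_eval_weyl_symbol:
  "mpoly_eval (weyl_symbol (weyl_op a)) v = (\<Sum>(\<alpha>, \<beta>)\<in>Poly_Mapping.keys a.
     Poly_Mapping.lookup a (\<alpha>, \<beta>) * mpow (\<lambda>i. v (Inl i)) \<alpha> * mpow (\<lambda>i. v (Inr i)) \<beta>)"
  by (simp add: weyl_symbol_def weyl_coeffs_weyl_op mpoly_eval_sum mpoly_eval_mult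
      mpoly_eval_mconst mpoly_eval_mpow mpoly_eval_mvar case_prod_unfold)

theorem theorem5p5:
  fixes T :: "'n::finite mpoly \<Rightarrow> 'n mpoly"
  assumes "T \<in> weyl_algebra"
    and "mpoly_subst (weyl_symbol T)
           (case_sum (\<lambda>i. mvar (Inl i)) (\<lambda>i. - mvar (Inr i)))
         \<in> (strictly_stable_polys :: ('n + 'n) mpoly set)"
  shows "T \<in> stable_weyl_algebra"
proof -
  obtain a where T: "T = weyl_op a"
    using assms(1) by (auto simp: weyl_algebra_def)
  have "mpoly_eval (weyl_op a f) z \<noteq> 0"
    if f: "f \<in> strictly_stable_polys" and z: "\<And>i. Im (z i) \<ge> 0" for f :: "'n mpoly" and z
  proof -
    \<comment> \<open>The powers of \<open>z\<close> are absorbed into the constants, so the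
      contraction differentiates \<open>f\<close> alone.\<close>
    let ?c = "\<lambda>y. Poly_Mapping.lookup a y * mpow z (fst y)"
    have "(\<Sum>y\<in>Poly_Mapping.keys a. ?c y * mpow (\<lambda>i. - w i) (snd y)) \<noteq> 0"
      if w: "\<And>i. Im (w i) \<ge> 0" for w
    proof -
      have "Im (case_sum z w j) \<ge> 0" for j
        using z w by (cases j) auto
      then have "mpoly_eval (mpoly_subst (weyl_symbol T)
          (case_sum (\<lambda>i. mvar (Inl i)) (\<lambda>i. - mvar (Inr i)))) (case_sum z w) \<noteq> 0"
        using assms(2) by (simp add: strictly_stable_polys_def)
      then show ?thesis
        by (simp add: T mpoly_eval_subst mpoly_eval_weyl_symbol mpoly_eval_mvar
            mpoly_eval_uminus case_prod_unfold)
    qed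
    \<comment> \<open>With every pair contracted, the product over the empty set
      \<open>- UNIV\<close> is \<open>1\<close>; \<open>z\<close> fills the place of
      \<open>w\<close>.\<close>
    then have "(\<Sum>y\<in>Poly_Mapping.keys a. ?c y *
        (\<Prod>i\<in>- UNIV. (- z i) ^ Poly_Mapping.lookup (snd y) i) *
        mpoly_eval (Finite_Set.fold (\<lambda>i. pderiv_var i ^^ Poly_Mapping.lookup (snd y) i) f UNIV) z) \<noteq> 0"
      using f z by (intro mixed_contraction_nonzero) auto
    then show ?thesis
      by (simp add: mpoly_eval_weyl_op mderiv_def case_prod_unfold)
  qed
  then show ?thesis
    using assms(1) by (auto simp: stable_weyl_algebra_def strictly_stable_polys_def T)
qed

end
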